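(* Let $G=(V,E)$ be a $3$ edge-connected graph of diameter $D$ with a source node $s$ holding a message $m_0$, where all nodes know a value $D'$ that is a constant-factor upper bound on $D$ (i.e., $D'\in[D,cD]$ for a constant $c\ge 1$). Let $L=7D'$ and suppose the nodes locally know an $(L,1)$ covering family $\mathcal{G}$ of $G$. Then there exists a deterministic algorithm in the adversarial \textsc{CONGEST} model that solves broadcast against a single adversarial edge within $O(\omega(\mathcal{G})\cdot L+|\mathcal{G}|)$ rounds.
   Context: An $(L,k)$ covering family of $G$ is a family of subgraphs $\mathcal{G}=\{G_1,\dots,G_\ell\}$, $G_i\subseteq G$, such that for every $u,v\in V$, every set $E'\subseteq E$ with $|E'|\le k$, and every $u$-$v$ path $P\subseteq G\setminus E'$ of length at most $L$, there is some $G_i$ with $P\subseteq G_i$ and $E'\cap G_i=\emptyset$. An ordered family $\mathcal{G}$ is locally known if, given the identifier of an edge $e=(u,v)$ and an index $i$, the nodes $u,v$ can locally determine whether $e\in G_i$. The width is $\omega(\mathcal{G})=\max_{e\in E}|\{G_i\in\mathcal{G}: e\notin G_i\}|$. Adversarial CONGEST model: $n$-node network $G$, unique $O(\log n)$-bit IDs, each node initially knows its incident edges' identifiers and a polynomial estimate of $n$; synchronous rounds with $O(\log n)$-bit messages per edge per round; a computationally unbounded adaptive adversary, knowing topology, protocol and random coins, controls a fixed unknown set of at most $t$ edges (here $t=1$) and may send arbitrary messages over them (possibly different per direction) based on all communication so far. Broadcast: all nodes must output $m_0$, ignoring all other messages. *)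

theory Defs
  imports Complex_Main
begin

text \<open>Finite simple graphs. A vertex is its identifier (a natural number), and the identifier
  of an edge is the set of its two endpoints.\<close>

type_synonym edge = "nat set"
type_synonym graph = "nat set \<times> edge set"

abbreviation verts :: "graph \<Rightarrow> nat set" where "verts \<equiv> fst"
abbreviation edges :: "graph \<Rightarrow> edge set" where "edges \<equiv> snd"

definition simple_graph :: "graph \<Rightarrow> bool" where
  "simple_graph G \<longleftrightarrow> finite (verts G) \<and>
     (\<forall>e\<in>edges G. \<exists>u\<in>verts G. \<exists>v\<in>verts G. u \<noteq> v \<and> e = {u, v})"

definition subgraph :: "graph \<Rightarrow> graph \<Rightarrow> bool" where
  "subgraph H G \<longleftrightarrow> simple_graph H \<and> verts H \<subseteq> verts G \<and> edges H \<subseteq> edges G"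

definition delete_edges :: "graph \<Rightarrow> edge set \<Rightarrow> graph" where
  "delete_edges G F = (verts G, edges G - F)"

fun path_edges :: "nat list \<Rightarrow> edge set" where
  "path_edges (x # y # zs) = insert {x, y} (path_edges (y # zs))"
| "path_edges _ = {}"

definition path_in :: "nat list \<Rightarrow> graph \<Rightarrow> bool" where
  "path_in p G \<longleftrightarrow> p \<noteq> [] \<and> distinct p \<and> set p \<subseteq> verts G \<and> path_edges p \<subseteq> edges G"

definition is_path :: "graph \<Rightarrow> nat \<Rightarrow> nat list \<Rightarrow> nat \<Rightarrow> bool" where
  "is_path G u p v \<longleftrightarrow> path_in p G \<and> hd p = u \<and> last p = v"

definition path_length :: "nat list \<Rightarrow> nat" where
  "path_length p = length p - 1"

definition connected_graph :: "graph \<Rightarrow> bool" where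
  "connected_graph G \<longleftrightarrow> (\<forall>u\<in>verts G. \<forall>v\<in>verts G. \<exists>p. is_path G u p v)"

definition edge_connected :: "nat \<Rightarrow> graph \<Rightarrow> bool" where
  "edge_connected k G \<longleftrightarrow> 1 < card (verts G) \<and>
     (\<forall>F. F \<subseteq> edges G \<and> card F < k \<longrightarrow> connected_graph (delete_edges G F))"

definition graph_dist :: "graph \<Rightarrow> nat \<Rightarrow> nat \<Rightarrow> nat" where
  "graph_dist G u v = (LEAST d. \<exists>p. is_path G u p v \<and> path_length p = d)"

definition diameter :: "graph \<Rightarrow> nat" where
  "diameter G = Max {graph_dist G u v | u v. u \<in> verts G \<and> v \<in> verts G}"


text \<open>Ordered families are lists; sizes and widths count indices, so repeated members count
  with multiplicity.\<close>

definition covering_family :: "nat \<Rightarrow> nat \<Rightarrow> graph \<Rightarrow> graph list \<Rightarrow> bool" where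
  "covering_family L k G Gs \<longleftrightarrow>
     (\<forall>H\<in>set Gs. subgraph H G) \<and>
     (\<forall>u\<in>verts G. \<forall>v\<in>verts G. \<forall>E' p.
        E' \<subseteq> edges G \<and> card E' \<le> k \<and>
        is_path (delete_edges G E') u p v \<and> path_length p \<le> L \<longrightarrow>
        (\<exists>H\<in>set Gs. path_in p H \<and> E' \<inter> edges H = {}))"

definition width :: "graph \<Rightarrow> graph list \<Rightarrow> nat" where
  "width G Gs = Max {card {i. i < length Gs \<and> e \<notin> edges (Gs ! i)} | e. e \<in> edges G}"


text \<open>The adversarial CONGEST model. A message is a bit string; the empty one stands for
  silence. A node's view is the list of its inboxes, one per completed round in
  chronological order. A deterministic algorithm determines the outgoing messages and the
  (possibly still undefined) output of a node from its initial knowledge and its view; as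
  local computation is unrestricted, this subsumes every formulation with local states.\<close>

type_synonym msg = "bool list"
type_synonym inbox = "edge \<Rightarrow> msg"
type_synonym view = "inbox list"

record knowledge =
  own_id :: nat
  incident :: "edge set"
  size_est :: nat
  diam_est :: nat
  in_family :: "edge \<Rightarrow> nat \<Rightarrow> bool"
  source_msg :: "msg option"

text \<open>Only the source has a \<open>source_msg\<close>. Local knowledge of the family answers membership
  queries for incident edges only, and reveals neither the size nor the width of the family.\<close>

definition initial_knowledge ::
  "graph \<Rightarrow> nat \<Rightarrow> msg \<Rightarrow> nat \<Rightarrow> nat \<Rightarrow> graph list \<Rightarrow> nat \<Rightarrow> knowledge" where
  "initial_knowledge G s m0 N D' Gs v =
     \<lparr> own_id = v,
       incident = {e \<in> edges G. v \<in> e},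
       size_est = N,
       diam_est = D',
       in_family = (\<lambda>e i. e \<in> edges G \<and> v \<in> e \<and> i < length Gs \<and> e \<in> edges (Gs ! i)),
       source_msg = (if v = s then Some m0 else None) \<rparr>"

record algorithm =
  send :: "knowledge \<Rightarrow> view \<Rightarrow> edge \<Rightarrow> msg"
  result :: "knowledge \<Rightarrow> view \<Rightarrow> msg option"

text \<open>For each round, the transcript records the message that each node hands to each of its
  incident edges. An adversary chooses what is delivered over the edge \<open>e\<close> to its endpoint \<open>v\<close>,
  based on the transcript of all rounds up to and including the current one. As the algorithm is
  deterministic and adversaries are quantified after the graph and all inputs, this
  information determines the whole communication.\<close>

type_synonym transcript = "(nat \<Rightarrow> edge \<Rightarrow> msg) list"
type_synonym adversary = "transcript \<Rightarrow> edge \<Rightarrow> nat \<Rightarrow> msg"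

definition other_end :: "edge \<Rightarrow> nat \<Rightarrow> nat" where
  "other_end e v = (THE u. u \<in> e \<and> u \<noteq> v)"

definition outgoing ::
  "algorithm \<Rightarrow> graph \<Rightarrow> (nat \<Rightarrow> knowledge) \<Rightarrow> (nat \<Rightarrow> view) \<Rightarrow> nat \<Rightarrow> edge \<Rightarrow> msg" where
  "outgoing A G K h u e = (if e \<in> edges G \<and> u \<in> e then send A (K u) (h u) e else [])"

definition delivered ::
  "graph \<Rightarrow> edge set \<Rightarrow> (nat \<Rightarrow> edge \<Rightarrow> msg) \<Rightarrow> (edge \<Rightarrow> nat \<Rightarrow> msg) \<Rightarrow> nat \<Rightarrow> inbox" where
  "delivered G F out bad v e =
     (if e \<in> edges G \<and> v \<in> e then (if e \<in> F then bad e v else out (other_end e v) e) else [])"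

primrec execution ::
  "algorithm \<Rightarrow> graph \<Rightarrow> (nat \<Rightarrow> knowledge) \<Rightarrow> edge set \<Rightarrow> adversary \<Rightarrow> nat \<Rightarrow>
     (nat \<Rightarrow> view) \<times> transcript" where
  "execution A G K F adv 0 = (\<lambda>v. [], [])"
| "execution A G K F adv (Suc r) =
     (let (h, tr) = execution A G K F adv r;
          out = outgoing A G K h;
          tr' = tr @ [out]
      in (\<lambda>v. h v @ [delivered G F out (adv tr') v], tr'))"

definition view_after ::
  "algorithm \<Rightarrow> graph \<Rightarrow> (nat \<Rightarrow> knowledge) \<Rightarrow> edge set \<Rightarrow> adversary \<Rightarrow> nat \<Rightarrow> nat \<Rightarrow> view" where
  "view_after A G K F adv r v = fst (execution A G K F adv r) v"

text \<open>Against every adversary controlling at most \<open>t\<close> edges, all messages fit into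
  \<open>B * log n\<close> bits, no node ever outputs anything but \<open>m0\<close>, and every node has output \<open>m0\<close>
  after \<open>T\<close> rounds.\<close>

definition solves_broadcast ::
  "algorithm \<Rightarrow> nat \<Rightarrow> nat \<Rightarrow> graph \<Rightarrow> (nat \<Rightarrow> knowledge) \<Rightarrow> msg \<Rightarrow> nat \<Rightarrow> bool" where
  "solves_broadcast A B t G K m0 T \<longleftrightarrow>
     (\<forall>F adv. F \<subseteq> edges G \<and> card F \<le> t \<and>
        (\<forall>tr e v. real (length (adv tr e v)) \<le> real B * log 2 (real (card (verts G)))) \<longrightarrow>
        (\<forall>r. \<forall>v\<in>verts G.
           (\<forall>e\<in>edges G. v \<in> e \<longrightarrow>
              real (length (send A (K v) (view_after A G K F adv r v) e))
                \<le> real B * log 2 (real (card (verts G)))) \<and>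
           result A (K v) (view_after A G K F adv r v) \<in> {None, Some m0} \<and>
           (T \<le> r \<longrightarrow> result A (K v) (view_after A G K F adv r v) = Some m0)))"

text \<open>The implicit constants of the model: identifiers and the broadcast message have at most
  \<open>\<kappa> * log n\<close> bits, and the estimate \<open>N\<close> of \<open>n\<close> is polynomial in both directions.\<close>

definition congest_parameters :: "nat \<Rightarrow> graph \<Rightarrow> msg \<Rightarrow> nat \<Rightarrow> bool" where
  "congest_parameters \<kappa> G m0 N \<longleftrightarrow>
     (\<forall>v\<in>verts G. v < card (verts G) ^ \<kappa>) \<and>
     real (length m0) \<le> real \<kappa> * log 2 (real (card (verts G))) \<and>
     card (verts G) \<le> N ^ \<kappa> \<and> N \<le> card (verts G) ^ \<kappa>"

end

theory Submission
  imports Defs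
begin

text \<open>The message is flooded over all members of the family at once: each node records the set of
  values it has heard in each \<open>G\<^sub>i\<close>, and passes on the first value and, once there is a second one,
  a conflict mark. If the faulty edge is not in \<open>G\<^sub>i\<close>, then only \<open>m0\<close> is ever heard there; and if
  \<open>G\<^sub>i\<close> contains a path from \<open>s\<close> to \<open>v\<close> that avoids the faulty edge, then \<open>v\<close> ends up with \<open>m0\<close>
  or a conflict mark, no matter what is forged. Now a node \<open>v\<close> accepts \<open>m\<close> from a neighbour that
  claims to have accepted \<open>m\<close>, over the edge \<open>f\<close> say, if \<open>m\<close> or a conflict mark occurs in some
  \<open>G\<^sub>i\<close> without \<open>f\<close>. This is safe: if \<open>f\<close> is faulty, that \<open>G\<^sub>i\<close> is clean. It is live: as \<open>G\<close> is
  3-edge-connected, a short path from \<open>s\<close> to \<open>v\<close> avoids both \<open>f\<close> and the faulty edge, and the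
  covering property for \<open>f\<close> puts it into some \<open>G\<^sub>i\<close> without \<open>f\<close>.\<close>

subsection \<open>Encoding of messages\<close>

text \<open>A self-delimiting code: \<open>True\<close> announces one more bit and
  \<open>False\<close> ends the word. Concatenated frames can therefore be split uniquely, at the
  price of doubling the length.\<close>

fun frame :: "bool list \<Rightarrow> bool list" where
  "frame [] = [False]"
| "frame (b # bs) = True # b # frame bs"

lemma frame_append_inject: "frame xs @ us = frame ys @ vs \<longleftrightarrow> xs = ys \<and> us = vs"
proof (induction xs arbitrary: ys)
  case Nil
  show ?case by (cases ys) auto
next
  case (Cons x xs)
  then show ?case by (cases ys) auto
qed

lemma length_frame: "length (frame xs) = 2 * length xs + 1"
  by (induction xs) auto

fun nat_bits :: "nat \<Rightarrow> bool list" where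
  "nat_bits n = (if n = 0 then [] else odd n # nat_bits (n div 2))"

declare nat_bits.simps [simp del]

lemma nat_bits_inject: "nat_bits m = nat_bits n \<longleftrightarrow> m = n"
proof
  show "nat_bits m = nat_bits n \<Longrightarrow> m = n"
  proof (induction m arbitrary: n rule: less_induct)
    case (less m)
    show ?case
    proof (cases "m = 0 \<or> n = 0")
      case True
      then show ?thesis
        using less.prems nat_bits.simps[of m] nat_bits.simps[of n] by (auto split: if_splits)
    next
      case False
      then have "odd m = odd n" and eq: "nat_bits (m div 2) = nat_bits (n div 2)"
        using less.prems nat_bits.simps[of m] nat_bits.simps[of n] by auto
      moreover have "m div 2 = n div 2"
        using less.IH[OF _ eq] False by simp
      ultimately show ?thesis
        by (metis even_two_times_div_two odd_two_times_div_two_succ)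
    qed
  qed
qed simp

lemma length_nat_bits:
  assumes "n < b"
  shows "2 ^ length (nat_bits n) \<le> 2 * b"
proof -
  have "n > 0 \<Longrightarrow> 2 ^ length (nat_bits n) \<le> 2 * n" for n
  proof (induction n rule: less_induct)
    case (less n)
    show ?case
    proof (cases "n = 1")
      case True
      then show ?thesis by (simp add: nat_bits.simps[of "Suc 0"] nat_bits.simps[of 0])
    next
      case False
      then have "2 ^ length (nat_bits (n div 2)) \<le> 2 * (n div 2)"
        using less by simp
      then show ?thesis
        using less.prems by (subst nat_bits.simps) auto
    qed
  qed
  from this[of n] show ?thesis
    using assms by (cases "n = 0") (simp_all add: nat_bits.simps[of 0])
qed

text \<open>In a round, a node tells each neighbour the message it has accepted, if any, and at most
  one item \<open>(k, x)\<close>: in the \<open>k\<close>-th subgraph it has heard the value \<open>x\<close>, where \<open>None\<close> stands for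
  contradictory values.\<close>

type_synonym token = "msg option \<times> (nat \<times> msg option) option"

fun option_bits :: "msg option \<Rightarrow> bool list" where
  "option_bits None = []"
| "option_bits (Some m) = True # m"

text \<open>The \<open>True\<close> before \<open>nat_bits k\<close> separates an item with
  \<open>k = 0\<close>, whose bit string is empty, from the absence of an item.\<close>

fun encode :: "token \<Rightarrow> msg" where
  "encode (a, None) = frame (option_bits a) @ frame [] @ frame []"
| "encode (a, Some (k, x)) =
     frame (option_bits a) @ frame (True # nat_bits k) @ frame (option_bits x)"

text \<open>On a forged message outside the range of \<^const>\<open>encode\<close> this is an arbitrary token.\<close>

definition decode :: "msg \<Rightarrow> token" where
  "decode = inv encode"

lemma option_bits_inject: "option_bits x = option_bits y \<longleftrightarrow> x = y"
  by (cases x; cases y) auto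

lemma inj_encode: "inj encode"
proof (rule injI)
  fix x y :: token
  assume eq: "encode x = encode y"
  have frame_inject: "frame xs = frame ys \<longleftrightarrow> xs = ys" for xs ys
    using frame_append_inject[of xs "[]" ys "[]"] by simp
  obtain a i b j where xy: "x = (a, i)" "y = (b, j)"
    by fastforce
  show "x = y"
    using eq unfolding xy
    by (cases i; cases j)
      (auto simp: frame_append_inject frame_inject option_bits_inject nat_bits_inject
        simp del: frame.simps)
qed

lemma decode_encode: "decode (encode x) = x"
  unfolding decode_def by (rule inv_f_f[OF inj_encode])

subsection \<open>The algorithm\<close>

definition summary :: "msg option set \<Rightarrow> msg option option" where
  "summary A = (if A = {} then None else if is_singleton A then Some (the_elem A) else Some None)"

text \<open>Measures the order nothing < one value < conflict. It climbs with every change of the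
  summary of a growing set, so an edge carries at most two items per index and direction.\<close>

definition rank :: "msg option option \<Rightarrow> nat" where
  "rank x = (case x of None \<Rightarrow> 0 | Some None \<Rightarrow> 2 | Some (Some _) \<Rightarrow> 1)"

definition supports :: "msg \<Rightarrow> msg option option \<Rightarrow> bool" where
  "supports m x \<longleftrightarrow> x = Some (Some m) \<or> x = Some None"

lemma summary_empty [simp]: "summary {} = None"
  by (simp add: summary_def)

lemma summary_singleton [simp]: "summary {x} = Some x"
  by (simp add: summary_def)

lemma summary_eq_None_iff: "summary A = None \<longleftrightarrow> A = {}"
  by (simp add: summary_def)

lemma summary_conflict:
  assumes "x \<in> A" "y \<in> A" "x \<noteq> y"
  shows "summary A = Some None"
  using assms by (auto simp: summary_def is_singleton_def)

lemma summary_cases: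
  obtains "A = {}" | x where "A = {x}" | "summary A = Some None"
  using summary_conflict by (metis is_singletonI' is_singletonE)

lemma summary_SomeD:
  assumes "summary A = Some (Some m)"
  shows "Some m \<in> A"
  using assms by (cases A rule: summary_cases) auto

lemma rank_le_2: "rank x \<le> 2"
  by (auto simp: rank_def split: option.splits)

lemma rank_None [simp]: "rank None = 0"
  by (simp add: rank_def)

lemma rank_conflict [simp]: "rank (Some None) = 2"
  by (simp add: rank_def)

text \<open>When a set grows, its summary can change only by leaving the empty state or by turning
  into a conflict. A conflict is final, whether it comes from two different values or from a
  received mark.\<close>

lemma rank_less_summary:
  assumes "A \<subseteq> B" "summary A \<noteq> summary B"
  shows "rank (summary A) < rank (summary B)"
proof (cases A rule: summary_cases)
  case 1
  then show ?thesis
    using assms by (cases B rule: summary_cases) (auto simp: rank_def split: option.splits)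
next
  case (2 x)
  then have "x \<in> B" "B \<noteq> {x}"
    using assms by auto
  then obtain y where "x \<in> B" "y \<in> B" "x \<noteq> y"
    by blast
  then have "summary B = Some None"
    by (rule summary_conflict)
  with 2 assms show ?thesis
    by (auto simp: rank_def split: option.splits)
next
  case 3
  then obtain y where "y \<in> A"
    by fastforce
  with 3 assms(1) have "summary B = Some None"
    by (cases B rule: summary_cases) (auto simp: subset_singleton_iff)
  with 3 assms show ?thesis by simp
qed

lemma rank_summary_mono: "A \<subseteq> B \<Longrightarrow> rank (summary A) \<le> rank (summary B)"
  using rank_less_summary[of A B] by fastforce

lemma summary_conflict_mono:
  assumes "A \<subseteq> B" "summary A = Some None"
  shows "summary B = Some None"
  using rank_less_summary[OF assms(1)] rank_le_2[of "summary B"] assms(2) by fastforce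

lemma supports_mono:
  assumes "A \<subseteq> B" "supports m (summary A)"
  shows "supports m (summary B)"
proof (cases "summary A = Some None")
  case True
  then show ?thesis
    using assms summary_conflict_mono by (auto simp: supports_def)
next
  case False
  then have "Some m \<in> B"
    using assms summary_SomeD by (auto simp: supports_def)
  then show ?thesis
    by (cases B rule: summary_cases) (auto simp: supports_def)
qed

lemma rank_summary_ge: "x \<in> A \<Longrightarrow> rank (Some x) \<le> rank (summary A)"
  using rank_summary_mono[of "{x}" A] by simp

lemma supports_summary: "x \<in> A \<Longrightarrow> supports m (Some x) \<Longrightarrow> supports m (summary A)"
  using supports_mono[of "{x}" A] by simp

lemma summary_clean:
  assumes "A \<subseteq> {y}" "summary A = Some x"
  shows "x = y"
  using assms by (cases "A = {}") (auto simp: subset_singleton_iff)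

lemma supports_summary_clean:
  assumes "A \<subseteq> {Some m}" "supports m' (summary A)"
  shows "m' = m"
  using assms by (cases "A = {}") (auto simp: supports_def subset_singleton_iff)

section \<open>Node states, their transitions, and the algorithm\<close>

record node_state =
  heard :: "nat \<Rightarrow> msg option set"
  sent :: "edge \<Rightarrow> nat \<Rightarrow> msg option option"
  accepted :: "msg option"

text \<open>The length of \<open>Gs\<close> need not be polynomial in \<open>n\<close>, so that its indices may not fit into
  messages. Hence only indices below \<open>Q\<^sup>2\<close> are used, where \<open>Q\<close> exceeds all identifiers, followed by
  the \<open>Q\<^sup>2\<close> subgraphs that omit a single edge \<open>{a, b}\<close>, with index \<open>Q\<^sup>2 + a * Q + b\<close>. The latter come
  last in the schedule, and are needed only if \<open>Gs\<close> has more than \<open>Q\<^sup>2\<close> members.\<close>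

definition member :: "nat \<Rightarrow> knowledge \<Rightarrow> edge \<Rightarrow> nat \<Rightarrow> bool" where
  "member Q K e k \<longleftrightarrow>
     (if k < Q\<^sup>2 then in_family K e k
      else k < 2 * Q\<^sup>2 \<and> e \<noteq> {(k - Q\<^sup>2) div Q, (k - Q\<^sup>2) mod Q})"

text \<open>Bounds the length of values that are taken over, so that forged ones cannot push relayed
  messages beyond the bandwidth. Conflict marks always pass.\<close>

definition admissible :: "nat \<Rightarrow> msg option \<Rightarrow> bool" where
  "admissible Q x \<longleftrightarrow> (\<forall>m. x = Some m \<longrightarrow> 2 ^ length m \<le> Q)"

definition pending :: "nat \<Rightarrow> knowledge \<Rightarrow> node_state \<Rightarrow> edge \<Rightarrow> nat \<Rightarrow> bool" where
  "pending Q K st e k \<longleftrightarrow>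
     member Q K e k \<and> summary (heard st k) \<noteq> None \<and> summary (heard st k) \<noteq> sent st e k"

text \<open>Smaller indices have priority. For any bound \<open>n\<close>, the indices below
  \<open>n\<close> therefore travel as if there were no others, and the delay analysis may ignore
  the rest of the schedule.\<close>

definition next_item ::
  "nat \<Rightarrow> knowledge \<Rightarrow> node_state \<Rightarrow> edge \<Rightarrow> (nat \<times> msg option) option" where
  "next_item Q K st e =
     (if \<exists>k. pending Q K st e k
      then let k = LEAST k. pending Q K st e k in Some (k, the (summary (heard st k)))
      else None)"

definition acceptable :: "nat \<Rightarrow> knowledge \<Rightarrow> node_state \<Rightarrow> inbox \<Rightarrow> msg \<Rightarrow> bool" where
  "acceptable Q K st ib m \<longleftrightarrow>
     (\<exists>e\<in>incident K. fst (decode (ib e)) = Some m \<and>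
        (\<exists>k. \<not> member Q K e k \<and> supports m (summary (heard st k))))"

definition step :: "nat \<Rightarrow> knowledge \<Rightarrow> node_state \<Rightarrow> inbox \<Rightarrow> node_state" where
  "step Q K st ib =
     \<lparr> heard = (\<lambda>k. heard st k \<union> {x. admissible Q x \<and>
         (\<exists>e\<in>incident K. member Q K e k \<and> snd (decode (ib e)) = Some (k, x))}),
       sent = (\<lambda>e. case next_item Q K st e of
         None \<Rightarrow> sent st e | Some (k, x) \<Rightarrow> (sent st e)(k := Some x)),
       accepted = (if accepted st = None \<and> Ex (acceptable Q K st ib)
         then Some (Eps (acceptable Q K st ib)) else accepted st) \<rparr>"

definition state_after :: "nat \<Rightarrow> knowledge \<Rightarrow> view \<Rightarrow> node_state" where
  "state_after Q K h = foldl (step Q K)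
     \<lparr> heard = (\<lambda>_. Some ` set_option (source_msg K)),
       sent = (\<lambda>_ _. None),
       accepted = source_msg K \<rparr> h"

text \<open>The exponent: from \<open>n \<le> N ^ \<kappa>\<close> follows
  \<open>n ^ \<kappa> \<le> Q\<close>, so that \<open>Q\<close> exceeds all identifiers, and from
  \<open>N \<le> n ^ \<kappa>\<close> follows
  \<open>Q \<le> n ^ (\<kappa> * (\<kappa> * \<kappa>))\<close>, so that \<open>log Q\<close> is
  still of order \<open>log n\<close>.\<close>

definition verified_flooding :: "nat \<Rightarrow> algorithm" where
  "verified_flooding \<kappa> =
     \<lparr> send = (\<lambda>K h e. let Q = size_est K ^ (\<kappa> * \<kappa>); st = state_after Q K h
         in encode (accepted st, next_item Q K st e)),
       result = (\<lambda>K h. accepted (state_after (size_est K ^ (\<kappa> * \<kappa>)) K h)) \<rparr>"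

lemma send_verified_flooding:
  "send (verified_flooding \<kappa>) K h e =
     (let Q = size_est K ^ (\<kappa> * \<kappa>); st = state_after Q K h
      in encode (accepted st, next_item Q K st e))"
  by (simp add: verified_flooding_def)

lemma next_item_eq_Some:
  assumes "next_item Q K st e = Some (k, x)"
  shows "pending Q K st e k" "summary (heard st k) = Some x"
proof -
  have *: "\<exists>k. pending Q K st e k" "k = (LEAST k. pending Q K st e k)"
    "x = the (summary (heard st k))"
    using assms by (auto simp: next_item_def Let_def split: if_splits)
  then show p: "pending Q K st e k"
    by (metis LeastI_ex)
  then show "summary (heard st k) = Some x"
    using * by (auto simp: pending_def)
qed

lemma next_item_pending:
  assumes "pending Q K st e k"
  obtains k' x where "next_item Q K st e = Some (k', x)" "k' \<le> k"
proof (rule that)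
  show "next_item Q K st e = Some (Least (pending Q K st e),
      the (summary (heard st (Least (pending Q K st e)))))"
    using assms by (auto simp: next_item_def Let_def)
  show "Least (pending Q K st e) \<le> k"
    using assms by (rule Least_le)
qed

text \<open>A frame of \<open>l\<close> bits takes \<open>2 * l + 1\<close>. With \<open>l\<close>
  at most \<open>1 + log Q\<close> for each of the two optional values and
  \<open>3 + 2 * log Q\<close> for the marked index, the total is
  \<open>(3 + 7 + 3) + (2 + 4 + 2) * log Q\<close>.\<close>

lemma length_encode:
  assumes "admissible Q a" "\<And>k x. i = Some (k, x) \<Longrightarrow> k < 2 * Q\<^sup>2 \<and> admissible Q x" "0 < Q"
  shows "real (length (encode (a, i))) \<le> 13 + 8 * log 2 (real Q)"
proof -
  have option: "real (length (option_bits x)) \<le> 1 + log 2 (real Q)" if "admissible Q x" for x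
  proof (cases x)
    case (Some m)
    then have "real (length m) \<le> log 2 (real Q)"
      using that assms(3) by (simp add: admissible_def le_log_of_power)
    with Some show ?thesis by simp
  qed (use assms(3) in simp)
  have index: "real (length (nat_bits k)) \<le> 2 + 2 * log 2 (real Q)" if "k < 2 * Q\<^sup>2" for k
  proof -
    have "2 ^ length (nat_bits k) \<le> (4 * Q\<^sup>2 :: nat)"
      using length_nat_bits[OF that] by simp
    then have "real (length (nat_bits k)) \<le> log 2 (real (4 * Q\<^sup>2))"
      using assms(3) by (metis le_log2_of_power of_nat_numeral)
    also have "\<dots> = log 2 4 + 2 * log 2 (real Q)"
      using assms(3) by (simp add: log_mult log_nat_power)
    also have "log 2 4 = (2 :: real)"
      using log_pow_cancel[of 2 2] by simp
    finally show ?thesis .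
  qed
  have "0 \<le> log 2 (real Q)"
    using assms(3) by simp
  then show ?thesis
    using option[OF assms(1)] assms(2) option index
    by (cases i) (fastforce simp: length_frame)+
qed


subsection \<open>Distances after the deletion of edges\<close>

text \<open>Relation powers of \<open>adj G\<close> describe walks. These can be joined and reversed
  without care for repeated vertices; simple paths are extracted only at the end.\<close>

definition adj :: "graph \<Rightarrow> (nat \<times> nat) set" where
  "adj G = {(u, v). {u, v} \<in> edges G}"

lemma adj_sym: "(u, v) \<in> adj G ^^ n \<Longrightarrow> (v, u) \<in> adj G ^^ n"
proof (induction n arbitrary: v)
  case (Suc n)
  then obtain w where "(u, w) \<in> adj G ^^ n" "(w, v) \<in> adj G"
    by auto
  then have "(v, w) \<in> adj G" "(w, u) \<in> adj G ^^ n"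
    using Suc.IH by (auto simp: adj_def insert_commute)
  then show ?case by (rule relpow_Suc_I2)
qed simp

lemma path_edges_nth: "Suc j < length p \<Longrightarrow> {p ! j, p ! Suc j} \<in> path_edges p"
proof (induction p arbitrary: j rule: path_edges.induct)
  case (1 x y zs)
  then show ?case by (cases j) auto
qed auto

lemma path_edges_append: "p \<noteq> [] \<Longrightarrow> path_edges (p @ [v]) = insert {last p, v} (path_edges p)"
  by (induction p rule: path_edges.induct) auto

lemma path_edges_take: "path_edges (take n p) \<subseteq> path_edges p"
proof (induction p arbitrary: n rule: path_edges.induct)
  case (1 x y zs)
  show ?case
  proof (cases n)
    case (Suc m)
    then show ?thesis
      using "1"[of m] by (cases m) auto
  qed simp
qed (auto simp: take_Cons split: nat.splits)

lemma path_relpow: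
  assumes "is_path G u p v"
  shows "(u, v) \<in> adj G ^^ path_length p"
proof -
  have "(p ! 0, p ! j) \<in> adj G ^^ j" if "j < length p" for j
    using that
  proof (induction j)
    case (Suc j)
    then have "{p ! j, p ! Suc j} \<in> edges G"
      using assms path_edges_nth[of j p] by (auto simp: is_path_def path_in_def)
    with Suc show ?case by (auto simp: adj_def)
  qed simp
  moreover have "p \<noteq> []" "u = p ! 0" "v = p ! path_length p"
    using assms by (auto simp: is_path_def path_in_def hd_conv_nth last_conv_nth path_length_def)
  ultimately show ?thesis
    by (simp add: path_length_def)
qed

lemma relpow_path:
  assumes "simple_graph G" "(u, v) \<in> adj G ^^ n" "u \<in> verts G"
  shows "\<exists>p. is_path G u p v \<and> path_length p \<le> n"
  using assms(2)
proof (induction n arbitrary: v)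
  case 0
  then show ?case
    using assms(3) by (intro exI[of _ "[u]"]) (auto simp: is_path_def path_in_def path_length_def)
next
  case (Suc n)
  then obtain w where w: "(u, w) \<in> adj G ^^ n" "{w, v} \<in> edges G"
    by (auto simp: adj_def)
  then obtain p where p: "is_path G u p w" "path_length p \<le> n"
    using Suc.IH by blast
  show ?case
  proof (cases "v \<in> set p")
    case True
    then obtain i where i: "i < length p" "p ! i = v"
      by (auto simp: in_set_conv_nth)
    \<comment> \<open>The walk returns to a vertex of the path, so the path is cut off
      there.\<close>
    let ?q = "take (Suc i) p"
    have "hd ?q = hd p" "last ?q = v"
      using i by (simp_all add: take_Suc_conv_app_nth last_append flip: hd_take[of "Suc i" p])
    moreover have "path_in ?q G"
      using p(1) path_edges_take[of "Suc i" p] set_take_subset[of "Suc i" p]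
      by (auto simp: is_path_def path_in_def)
    ultimately have "is_path G u ?q v"
      using p(1) by (simp add: is_path_def)
    moreover have "path_length ?q \<le> Suc n"
      using p by (simp add: path_length_def)
    ultimately show ?thesis by blast
  next
    case False
    have "v \<in> verts G"
      using assms(1) w(2) by (force simp: simple_graph_def doubleton_eq_iff)
    then have "is_path G u (p @ [v]) v"
      using p(1) w(2) False
      by (auto simp: is_path_def path_in_def path_edges_append)
    moreover have "path_length (p @ [v]) \<le> Suc n"
      using p by (auto simp: path_length_def)
    ultimately show ?thesis by blast
  qed
qed

lemma relpow_le_trans:
  assumes "\<exists>i\<le>m. (u, v) \<in> R ^^ i" "\<exists>j\<le>n. (v, w) \<in> R ^^ j"
  shows "\<exists>k\<le>m + n. (u, w) \<in> R ^^ k"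
  using assms relpow_add by (metis add_mono relcompI)

lemma connected_graph_relpow:
  assumes "connected_graph G" "u \<in> verts G" "v \<in> verts G"
  shows "(u, v) \<in> (adj G)\<^sup>*"
  using assms path_relpow relpow_imp_rtrancl by (metis connected_graph_def)

lemma connected_graph_exit:
  assumes "connected_graph G" "simple_graph G" "u \<in> A" "u \<in> verts G" "\<not> verts G \<subseteq> A"
  obtains a b where "(a, b) \<in> adj G" "a \<in> A" "b \<notin> A" "b \<in> verts G"
proof -
  obtain v where v: "v \<in> verts G" "v \<notin> A"
    using assms(5) by auto
  have "(u, v) \<in> (adj G)\<^sup>*"
    using assms v by (simp add: connected_graph_relpow)
  then have "\<exists>a b. (a, b) \<in> adj G \<and> a \<in> A \<and> b \<notin> A"
    using v(2) assms(3) by (induction rule: rtrancl_induct) auto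
  then obtain a b where ab: "(a, b) \<in> adj G" "a \<in> A" "b \<notin> A"
    by blast
  moreover have "b \<in> verts G"
    using ab(1) assms(2) by (force simp: simple_graph_def adj_def doubleton_eq_iff)
  ultimately show ?thesis
    using that by blast
qed

lemma diameter_relpow:
  assumes "connected_graph G" "simple_graph G" "u \<in> verts G" "v \<in> verts G"
  shows "\<exists>i\<le>diameter G. (u, v) \<in> adj G ^^ i"
proof -
  have "\<exists>d p. is_path G u p v \<and> path_length p = d"
    using assms by (auto simp: connected_graph_def)
  then have "\<exists>p. is_path G u p v \<and> path_length p = graph_dist G u v"
    unfolding graph_dist_def by (rule LeastI_ex)
  then have "(u, v) \<in> adj G ^^ graph_dist G u v"
    using path_relpow by metis
  moreover have "{graph_dist G u v | u v. u \<in> verts G \<and> v \<in> verts G} =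
      case_prod (graph_dist G) ` (verts G \<times> verts G)"
    by auto
  then have "finite {graph_dist G u v | u v. u \<in> verts G \<and> v \<in> verts G}"
    using assms(2) by (simp add: simple_graph_def)
  then have "graph_dist G u v \<le> diameter G"
    unfolding diameter_def using assms(3,4) by (intro Max_ge) auto
  ultimately show ?thesis by blast
qed

lemma simple_graph_delete_edges: "simple_graph G \<Longrightarrow> simple_graph (delete_edges G F)"
  by (auto simp: simple_graph_def delete_edges_def)

text \<open>Deleting \<open>F\<close> splits a breadth-first tree with root \<open>s\<close> into parts; \<open>R\<close> consists of the top
  vertices of those that do not contain \<open>s\<close>.\<close>

lemma bfs_parts:
  assumes "finite F" "\<And>v. v \<in> V \<Longrightarrow> \<exists>i\<le>D. (s, v) \<in> adj G ^^ i"
  obtains R where "finite R" "card R \<le> card F" "s \<notin> R"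
    "\<And>v. v \<in> V \<Longrightarrow> \<exists>c\<in>insert s R. \<exists>i\<le>D. (c, v) \<in> adj (delete_edges G F) ^^ i"
proof -
  define d where "d v = (LEAST i. (s, v) \<in> adj G ^^ i)" for v
  have d: "(s, v) \<in> adj G ^^ d v" "d v \<le> i" if "(s, v) \<in> adj G ^^ i" for v i
    using that unfolding d_def by (rule LeastI, rule Least_le)
  define par where "par v = (SOME u. (u, v) \<in> adj G \<and> (\<exists>i. (s, u) \<in> adj G ^^ i) \<and> d v = Suc (d u))"
    for v
  have par: "(par v, v) \<in> adj G" "\<exists>i. (s, par v) \<in> adj G ^^ i" "d v = Suc (d (par v))"
    if v: "v \<noteq> s" "\<exists>i. (s, v) \<in> adj G ^^ i" for v
  proof -
    have sv: "(s, v) \<in> adj G ^^ d v"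
      using d(1) v(2) by blast
    obtain k where k: "d v = Suc k"
      using sv v(1) by (cases "d v") auto
    then obtain u where u: "(s, u) \<in> adj G ^^ k" "(u, v) \<in> adj G"
      using sv by auto
    then have "(s, v) \<in> adj G ^^ Suc (d u)"
      using d(1) by auto
    then have "d v = Suc (d u)"
      using d(2)[of v] d(2)[OF u(1)] k by fastforce
    then have "\<exists>u. (u, v) \<in> adj G \<and> (\<exists>i. (s, u) \<in> adj G ^^ i) \<and> d v = Suc (d u)"
      using u by blast
    from someI_ex[OF this] show "(par v, v) \<in> adj G" "\<exists>i. (s, par v) \<in> adj G ^^ i"
      "d v = Suc (d (par v))"
      unfolding par_def by blast+
  qed
  define R where "R = {v. v \<noteq> s \<and> (\<exists>i. (s, v) \<in> adj G ^^ i) \<and> {par v, v} \<in> F}"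
  \<comment> \<open>Each top vertex in \<open>R\<close> is charged to the deleted tree edge above
    it. Two of them cannot share that edge, since each would be the parent of the other, against the
    depths.\<close>
  have inj: "inj_on (\<lambda>v. {par v, v}) R"
  proof (rule inj_onI)
    fix v w assume vw: "v \<in> R" "w \<in> R" "{par v, v} = {par w, w}"
    show "v = w"
    proof (rule ccontr)
      assume "v \<noteq> w"
      then have "par v = w" "par w = v"
        using vw(3) by (auto simp: doubleton_eq_iff)
      then show False
        using vw(1,2) par(3)[of v] par(3)[of w] by (auto simp: R_def)
    qed
  qed
  have sub: "(\<lambda>v. {par v, v}) ` R \<subseteq> F"
    by (auto simp: R_def)
  have part: "\<exists>c\<in>insert s R. \<exists>i\<le>d v. (c, v) \<in> adj (delete_edges G F) ^^ i"
    if "\<exists>i. (s, v) \<in> adj G ^^ i" for v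
    using that
  proof (induction "d v" arbitrary: v rule: less_induct)
    case less
    show ?case
    proof (cases "v \<in> insert s R")
      case True
      then show ?thesis
        by (intro bexI[of _ v] exI[of _ 0]) auto
    next
      case False
      then have v: "v \<noteq> s" "{par v, v} \<notin> F"
        using less.prems by (auto simp: R_def)
      obtain c i where c: "c \<in> insert s R" "i \<le> d (par v)"
        "(c, par v) \<in> adj (delete_edges G F) ^^ i"
        using less.hyps[of "par v"] par[OF v(1) less.prems] by auto
      have "(par v, v) \<in> adj (delete_edges G F)"
        using par(1)[OF v(1) less.prems] v(2) by (auto simp: adj_def delete_edges_def)
      with c have "(c, v) \<in> adj (delete_edges G F) ^^ Suc i" "Suc i \<le> d v"
        using par(3)[OF v(1) less.prems] by auto
      with c(1) show ?thesis by blast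
    qed
  qed
  show ?thesis
  proof (rule that)
    show "finite R"
      using inj_on_finite[OF inj sub assms(1)] .
    show "card R \<le> card F"
      using card_inj_on_le[OF inj sub assms(1)] .
    show "s \<notin> R"
      by (simp add: R_def)
    show "\<exists>c\<in>insert s R. \<exists>i\<le>D. (c, v) \<in> adj (delete_edges G F) ^^ i" if "v \<in> V" for v
      using assms(2)[OF that] part[of v] d(2)[of v] by (meson order_trans)
  qed
qed

text \<open>At most three tree parts remain, and any two vertices of one part are at most
  \<open>2 * D\<close> apart, via its top. The ball of radius \<open>D\<close> around
  \<open>s\<close> contains the part of \<open>s\<close>; by connectivity one further step reaches a
  second part, which is exhausted at radius \<open>3 * D + 1\<close>, and the third one is exhausted
  at radius \<open>5 * D + 2\<close>.\<close>

lemma relpow_delete_two_edges: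
  assumes "simple_graph G" "connected_graph G" "connected_graph (delete_edges G F)"
    "finite F" "card F \<le> 2" "s \<in> verts G" "v \<in> verts G"
  shows "\<exists>i\<le>5 * diameter G + 2. (s, v) \<in> adj (delete_edges G F) ^^ i"
proof -
  let ?H = "delete_edges G F" and ?D = "diameter G" and ?V = "verts G"
  obtain R where R: "finite R" "card R \<le> card F" "s \<notin> R"
    "\<And>v. v \<in> ?V \<Longrightarrow> \<exists>c\<in>insert s R. \<exists>i\<le>?D. (c, v) \<in> adj ?H ^^ i"
    using bfs_parts[OF assms(4), of ?V ?D s G] diameter_relpow[OF assms(2,1,6)] by blast
  have H: "simple_graph ?H" "verts ?H = ?V"
    using simple_graph_delete_edges[OF assms(1)] by (auto simp: delete_edges_def)
  define B where "B r = {v. \<exists>i\<le>r. (s, v) \<in> adj ?H ^^ i}" for r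
  have B_mono: "B r \<subseteq> B r'" if "r \<le> r'" for r r'
    using that by (auto simp: B_def intro: order_trans)
  obtain c where c: "\<And>v. v \<in> ?V \<Longrightarrow> c v \<in> insert s R"
    "\<And>v. v \<in> ?V \<Longrightarrow> \<exists>i\<le>?D. (c v, v) \<in> adj ?H ^^ i"
    using R(4) by metis
  have root: "v \<in> B ?D" if "v \<in> ?V" "c v = s" for v
    using c(2)[OF that(1)] that(2) by (auto simp: B_def)
  have part: "w \<in> B (r + 2 * ?D)" if "v \<in> B r" "v \<in> ?V" "w \<in> ?V" "c w = c v" for v w r
  proof -
    have "\<exists>i\<le>?D. (v, c v) \<in> adj ?H ^^ i"
      using c(2)[OF that(2)] adj_sym by blast
    from relpow_le_trans[OF this c(2)[OF that(3), unfolded that(4)]]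
    have "\<exists>i\<le>?D + ?D. (v, w) \<in> adj ?H ^^ i" .
    from relpow_le_trans[OF _ this, of r s]
    have "\<exists>i\<le>r + (?D + ?D). (s, w) \<in> adj ?H ^^ i"
      using that(1) by (simp add: B_def)
    then show ?thesis
      by (simp add: B_def mult_2)
  qed
  have exit: "\<exists>b. b \<in> ?V \<and> b \<in> B (Suc r) \<and> b \<notin> B r" if not: "\<not> ?V \<subseteq> B r" for r
  proof -
    have "s \<in> B r"
      by (auto simp: B_def intro: exI[of _ 0])
    then obtain a b where ab: "(a, b) \<in> adj ?H" "a \<in> B r" "b \<notin> B r" "b \<in> ?V"
      using connected_graph_exit[OF assms(3) H(1), of s "B r"] assms(6) not H(2) by metis
    then have "b \<in> B (Suc r)"
      by (auto simp: B_def intro: relpow_Suc_I)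
    with ab show ?thesis by blast
  qed
  have "?V \<subseteq> B (5 * ?D + 2)"
  proof (rule ccontr)
    assume not: "\<not> ?V \<subseteq> B (5 * ?D + 2)"
    have ex1: "\<not> ?V \<subseteq> B ?D" and ex2: "\<not> ?V \<subseteq> B (3 * ?D + 1)"
      using not B_mono[of ?D "5 * ?D + 2"] B_mono[of "3 * ?D + 1" "5 * ?D + 2"] by auto
    \<comment> \<open>A vertex \<open>z\<close> outside the largest ball would lie in a part
      different from those of \<open>s\<close>, \<open>x\<close> and \<open>y\<close>. As these
      three parts differ too, \<open>R\<close> would need three elements.\<close>
    obtain x where x: "x \<in> ?V" "x \<in> B (Suc ?D)" "x \<notin> B ?D"
      using exit[OF ex1] by blast
    obtain y where y: "y \<in> ?V" "y \<in> B (Suc (3 * ?D + 1))" "y \<notin> B (3 * ?D + 1)"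
      using exit[OF ex2] by blast
    obtain z where z: "z \<in> ?V" "z \<notin> B (5 * ?D + 2)"
      using not by blast
    have "z \<notin> B (Suc ?D + 2 * ?D)" "z \<notin> B ?D" "y \<notin> B ?D" "z \<notin> B (Suc (3 * ?D + 1) + 2 * ?D)"
      using z y B_mono[of ?D "5 * ?D + 2"] B_mono[of ?D "3 * ?D + 1"]
        B_mono[of "Suc ?D + 2 * ?D" "5 * ?D + 2"] by (auto simp: algebra_simps)
    moreover have "y \<notin> B (Suc ?D + 2 * ?D)"
      using y by (simp add: algebra_simps)
    ultimately have "c x \<noteq> s" "c y \<noteq> s" "c z \<noteq> s" "c y \<noteq> c x" "c z \<noteq> c x" "c z \<noteq> c y"
      using root[OF x(1)] root[OF y(1)] root[OF z(1)] part[OF x(2,1) y(1)] part[OF x(2,1) z(1)]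
        part[OF y(2,1) z(1)] x(3) by blast+
    then have "card {c x, c y, c z} = 3" "{c x, c y, c z} \<subseteq> R"
      using c(1)[OF x(1)] c(1)[OF y(1)] c(1)[OF z(1)] by auto
    then have "3 \<le> card R"
      using card_mono[OF R(1), of "{c x, c y, c z}"] by simp
    then show False
      using R(2) assms(5) by simp
  qed
  then show ?thesis
    using assms(7) by (auto simp: B_def)
qed


subsection \<open>Safety\<close>

locale flooding_run =
  fixes \<kappa> :: nat and G :: graph and s :: nat and m0 :: msg and N D' :: nat and Gs :: "graph list"
    and F :: "edge set" and adv :: adversary
  assumes graph: "simple_graph G"
    and faulty: "F \<subseteq> edges G" "card F \<le> 1"
    and m0: "2 ^ length m0 \<le> N ^ (\<kappa> * \<kappa>)"
begin

abbreviation Q :: nat where "Q \<equiv> N ^ (\<kappa> * \<kappa>)"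

abbreviation K :: "nat \<Rightarrow> knowledge" where "K \<equiv> initial_knowledge G s m0 N D' Gs"

abbreviation view :: "nat \<Rightarrow> nat \<Rightarrow> view" where
  "view \<equiv> view_after (verified_flooding \<kappa>) G K F adv"

definition state :: "nat \<Rightarrow> nat \<Rightarrow> node_state" where
  "state r v = state_after Q (K v) (view r v)"

text \<open>\<open>member\<close> without reference to a node: both endpoints of an edge agree on
  the indices available there.\<close>

definition mem :: "edge \<Rightarrow> nat \<Rightarrow> bool" where
  "mem e k \<longleftrightarrow>
     (if k < Q\<^sup>2 then k < length Gs \<and> e \<in> edges (Gs ! k)
      else k < 2 * Q\<^sup>2 \<and> e \<noteq> {(k - Q\<^sup>2) div Q, (k - Q\<^sup>2) mod Q})"

lemma incident_K: "incident (K v) = {e \<in> edges G. v \<in> e}"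
  by (simp add: initial_knowledge_def)

lemma member_iff: "e \<in> edges G \<Longrightarrow> v \<in> e \<Longrightarrow> member Q (K v) e k \<longleftrightarrow> mem e k"
  by (auto simp: member_def mem_def initial_knowledge_def)

lemma finite_edges: "finite (edges G)"
proof (rule finite_subset)
  show "edges G \<subseteq> Pow (verts G)" "finite (Pow (verts G))"
    using graph by (auto simp: simple_graph_def)
qed

lemma edge_endpoints:
  assumes "e \<in> edges G" "v \<in> e"
  obtains u where "e = {u, v}" "u \<noteq> v"
proof -
  obtain a b where "e = {a, b}" "a \<noteq> b"
    using graph assms(1) by (auto simp: simple_graph_def)
  then show ?thesis
    using that[of a] that[of b] assms(2) by (auto simp: insert_commute)
qed

lemma state_0:
  "state 0 v = \<lparr> heard = (\<lambda>_. if v = s then {Some m0} else {}), sent = (\<lambda>_ _. None),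
     accepted = (if v = s then Some m0 else None) \<rparr>"
  by (simp add: state_def state_after_def view_after_def initial_knowledge_def)

text \<open>All that is ever used about an inbox: fault-free edges transmit faithfully. Entries of
  faulty edges stay arbitrary, which covers every adversary.\<close>

lemma state_Suc:
  obtains ib where "state (Suc r) v = step Q (K v) (state r v) ib"
    "\<And>u. {u, v} \<in> edges G \<Longrightarrow> {u, v} \<notin> F \<Longrightarrow>
       decode (ib {u, v}) = (accepted (state r u), next_item Q (K u) (state r u) {u, v})"
proof -
  obtain h tr where ex: "execution (verified_flooding \<kappa>) G K F adv r = (h, tr)"
    by fastforce
  define out where "out = outgoing (verified_flooding \<kappa>) G K h"
  define ib where "ib = delivered G F out (adv (tr @ [out])) v"
  have h: "view r u = h u" for u
    by (simp add: view_after_def ex)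
  have "view (Suc r) v = view r v @ [ib]"
    unfolding view_after_def by (simp add: ex Let_def out_def ib_def)
  then have "state (Suc r) v = step Q (K v) (state r v) ib"
    by (simp add: state_def state_after_def)
  moreover have "decode (ib {u, v}) =
      (accepted (state r u), next_item Q (K u) (state r u) {u, v})"
    if e: "{u, v} \<in> edges G" "{u, v} \<notin> F" for u
  proof -
    have "u \<noteq> v"
      using graph e(1) by (auto simp: simple_graph_def doubleton_eq_iff)
    then have "other_end {u, v} v = u"
      unfolding other_end_def by (intro the_equality) auto
    moreover have "size_est (K u) = N"
      by (simp add: initial_knowledge_def)
    ultimately show ?thesis
      using e by (simp add: ib_def delivered_def out_def outgoing_def send_verified_flooding
          Let_def decode_encode state_def h)
  qed
  ultimately show ?thesis
    using that by blast
qed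

lemma heard_Suc: "heard (state r v) k \<subseteq> heard (state (Suc r) v) k"
  by (rule state_Suc[of r v]) (auto simp: step_def)

lemma heard_mono: "r \<le> r' \<Longrightarrow> heard (state r v) k \<subseteq> heard (state r' v) k"
  by (rule lift_Suc_mono_le[of "\<lambda>r. heard (state r v) k"]) (rule heard_Suc)

lemma source_heard: "Some m0 \<in> heard (state r s) k"
  using heard_mono[of 0 r s k] by (auto simp: state_0)

lemma heard_admissible: "x \<in> heard (state r v) k \<Longrightarrow> admissible Q x"
proof (induction r)
  case 0
  then show ?case
    using m0 by (auto simp: state_0 admissible_def split: if_splits)
next
  case (Suc r)
  show ?case
    by (rule state_Suc[of r v]) (use Suc in \<open>auto simp: step_def\<close>)
qed

lemma summary_admissible:
  assumes "summary (heard (state r v) k) = Some x"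
  shows "admissible Q x"
proof (cases x)
  case (Some m)
  then show ?thesis
    using assms summary_SomeD heard_admissible by blast
qed (simp add: admissible_def)

lemma sent_Suc:
  "sent (state (Suc r) v) e =
     (case next_item Q (K v) (state r v) e of
        None \<Rightarrow> sent (state r v) e
      | Some (k, x) \<Rightarrow> (sent (state r v) e)(k := Some x))"
  by (rule state_Suc[of r v]) (simp add: step_def)

lemma sent_Suc_cases:
  assumes "sent (state (Suc r) v) e k \<noteq> sent (state r v) e k"
  obtains x where "next_item Q (K v) (state r v) e = Some (k, x)"
    "sent (state (Suc r) v) e k = Some x" "summary (heard (state r v) k) = Some x"
    "pending Q (K v) (state r v) e k"
proof (cases "next_item Q (K v) (state r v) e")
  case None
  then show ?thesis
    using assms by (simp add: sent_Suc)
next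
  case (Some y)
  then obtain x where "y = (k, x)"
    using assms by (cases y) (auto simp: sent_Suc split: if_splits)
  then show ?thesis
    using that[of x] Some next_item_eq_Some[of Q "K v" "state r v" e k x]
    by (simp add: sent_Suc)
qed

text \<open>The last item sent is the summary of an earlier, hence smaller, set of heard values.
  This makes the monotonicity of summaries applicable to \<open>sent\<close>.\<close>

lemma sent_summary: "\<exists>A\<subseteq>heard (state r v) k. sent (state r v) e k = summary A"
proof (induction r)
  case 0
  show ?case by (rule exI[of _ "{}"]) (simp add: state_0)
next
  case (Suc r)
  show ?case
  proof (cases "sent (state (Suc r) v) e k = sent (state r v) e k")
    case True
    then show ?thesis
      using Suc heard_Suc[of r v k] by (metis order_trans)
  next
    case False
    then have "sent (state (Suc r) v) e k = summary (heard (state r v) k)"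
      by (rule sent_Suc_cases) simp
    then show ?thesis
      by (intro exI[of _ "heard (state r v) k"]) (simp add: heard_Suc)
  qed
qed

lemma sent_mem:
  assumes "e \<in> edges G" "v \<in> e"
  shows "sent (state r v) e k \<noteq> None \<Longrightarrow> mem e k"
proof (induction r)
  case (Suc r)
  show ?case
  proof (cases "sent (state (Suc r) v) e k = sent (state r v) e k")
    case False
    then have "pending Q (K v) (state r v) e k"
      by (rule sent_Suc_cases)
    then show ?thesis
      using member_iff[OF assms] by (simp add: pending_def)
  qed (use Suc in simp)
qed (simp add: state_0)

text \<open>The same \<open>r\<close> occurs on both sides because the step in which
  \<open>u\<close> records an item as sent is the one in which \<open>v\<close> receives it. The
  length filter of \<open>v\<close> lets it pass, since \<open>u\<close> only holds admissible
  values.\<close>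

lemma sent_heard:
  assumes "{u, v} \<in> edges G" "{u, v} \<notin> F"
  shows "sent (state r u) {u, v} k = Some x \<Longrightarrow> x \<in> heard (state r v) k"
proof (induction r)
  case (Suc r)
  show ?case
  proof (cases "sent (state (Suc r) u) {u, v} k = sent (state r u) {u, v} k")
    case True
    then show ?thesis
      using Suc heard_Suc by auto
  next
    case False
    then obtain y where y: "next_item Q (K u) (state r u) {u, v} = Some (k, y)"
      "sent (state (Suc r) u) {u, v} k = Some y" "summary (heard (state r u) k) = Some y"
      "pending Q (K u) (state r u) {u, v} k"
      by (rule sent_Suc_cases)
    have "y = x" "admissible Q x"
      using y(2,3) Suc.prems summary_admissible by auto
    moreover have "member Q (K v) {u, v} k"
      using y(4) member_iff[OF assms(1)] by (simp add: pending_def)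
    moreover obtain ib where "state (Suc r) v = step Q (K v) (state r v) ib"
      "\<And>u. {u, v} \<in> edges G \<Longrightarrow> {u, v} \<notin> F \<Longrightarrow>
         decode (ib {u, v}) = (accepted (state r u), next_item Q (K u) (state r u) {u, v})"
      by (rule state_Suc[of r v]) blast
    ultimately show ?thesis
      using assms y(1) by (auto simp: step_def incident_K intro!: bexI[of _ "{u, v}"])
  qed
qed (simp add: state_0)

lemma supports_sent_heard:
  assumes "{u, v} \<in> edges G" "{u, v} \<notin> F" "supports m (sent (state r u) {u, v} k)"
  shows "supports m (summary (heard (state r v) k))"
proof -
  obtain x where x: "sent (state r u) {u, v} k = Some x"
    using assms(3) by (auto simp: supports_def)
  then have "x \<in> heard (state r v) k"
    using assms(1,2) sent_heard by blast
  then show ?thesis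
    using assms(3) unfolding x by (rule supports_summary)
qed

lemma heard_clean:
  assumes "\<forall>e\<in>F. \<not> mem e k"
  shows "heard (state r v) k \<subseteq> {Some m0}"
proof (induction r arbitrary: v)
  case (Suc r)
  obtain ib where ib: "state (Suc r) v = step Q (K v) (state r v) ib"
    "\<And>u. {u, v} \<in> edges G \<Longrightarrow> {u, v} \<notin> F \<Longrightarrow>
       decode (ib {u, v}) = (accepted (state r u), next_item Q (K u) (state r u) {u, v})"
    by (rule state_Suc[of r v]) blast
  show ?case
  proof
    fix x assume "x \<in> heard (state (Suc r) v) k"
    then consider "x \<in> heard (state r v) k"
      | e where "e \<in> edges G" "v \<in> e" "member Q (K v) e k" "snd (decode (ib e)) = Some (k, x)"
      by (auto simp: ib(1) step_def incident_K)
    then show "x \<in> {Some m0}"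
    proof cases
      case 2
      then obtain u where u: "e = {u, v}"
        using edge_endpoints by metis
      have "e \<notin> F"
        using 2 member_iff assms by blast
      then have "next_item Q (K u) (state r u) e = Some (k, x)"
        using ib(2)[of u] 2 u by simp
      then have "summary (heard (state r u) k) = Some x"
        by (rule next_item_eq_Some)
      then show ?thesis
        using summary_clean[OF Suc.IH] by simp
    qed (use Suc.IH in blast)
  qed
qed (simp add: state_0)

text \<open>The first node that accepts a forged message receives it over the faulty edge, and the
  index that made it accept is free of forgeries.\<close>

lemma accepted_safe: "accepted (state r v) \<in> {None, Some m0}"
proof (induction r arbitrary: v)
  case (Suc r)
  obtain ib where ib: "state (Suc r) v = step Q (K v) (state r v) ib"
    "\<And>u. {u, v} \<in> edges G \<Longrightarrow> {u, v} \<notin> F \<Longrightarrow>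
       decode (ib {u, v}) = (accepted (state r u), next_item Q (K u) (state r u) {u, v})"
    by (rule state_Suc[of r v]) blast
  have "m = m0" if "acceptable Q (K v) (state r v) ib m" for m
  proof -
    obtain e k where e: "e \<in> edges G" "v \<in> e" "fst (decode (ib e)) = Some m"
      "\<not> member Q (K v) e k" "supports m (summary (heard (state r v) k))"
      using \<open>acceptable Q (K v) (state r v) ib m\<close> by (auto simp: acceptable_def incident_K)
    show ?thesis
    proof (cases "e \<in> F")
      case True
      have "finite F"
        using faulty(1) finite_edges by (rule finite_subset)
      with True faulty(2) have "F = {e}"
        by (auto simp: card_le_Suc0_iff_eq)
      then have "heard (state r v) k \<subseteq> {Some m0}"
        using e member_iff by (intro heard_clean) auto
      then show ?thesis
        using e(5) by (rule supports_summary_clean)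
    next
      case False
      obtain u where "e = {u, v}"
        using edge_endpoints e by metis
      then have "accepted (state r u) = Some m"
        using ib(2)[of u] e False by simp
      then show ?thesis
        using Suc.IH[of u] by simp
    qed
  qed
  then have "Ex (acceptable Q (K v) (state r v) ib) \<Longrightarrow> Eps (acceptable Q (K v) (state r v) ib) = m0"
    by (metis someI_ex)
  then show ?case
    using Suc.IH[of v] by (simp add: ib(1) step_def)
qed (simp add: state_0)

lemma accepted_Suc:
  assumes "accepted (state r v) = Some m0"
  shows "accepted (state (Suc r) v) = Some m0"
  by (rule state_Suc[of r v]) (simp add: step_def assms)

lemma length_send:
  "real (length (send (verified_flooding \<kappa>) (K v) (view r v) e)) \<le> 13 + 8 * log 2 (real Q)"
proof -
  have size: "size_est (K v) = N"
    by (simp add: initial_knowledge_def)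
  have Q: "0 < Q"
    using m0 by (metis less_le_trans zero_less_numeral zero_less_power)
  have "real (length (encode (accepted (state r v), next_item Q (K v) (state r v) e)))
      \<le> 13 + 8 * log 2 (real Q)"
  proof (rule length_encode[OF _ _ Q])
    \<comment> \<open>Acceptance is not filtered by length; safety provides the bound, as only
      \<open>m0\<close> is ever accepted.\<close>
    show "admissible Q (accepted (state r v))"
      using accepted_safe[of r v] m0 by (auto simp: admissible_def)
    fix k x assume item: "next_item Q (K v) (state r v) e = Some (k, x)"
    have "k < 2 * Q\<^sup>2"
      using next_item_eq_Some(1)[OF item] by (auto simp: pending_def member_def split: if_splits)
    moreover have "admissible Q x"
      using next_item_eq_Some(2)[OF item] by (rule summary_admissible)
    ultimately show "k < 2 * Q\<^sup>2 \<and> admissible Q x" ..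
  qed
  then show ?thesis
    by (simp add: send_verified_flooding Let_def size state_def)
qed

subsection \<open>Pipelining\<close>

text \<open>A potential: every item with index below \<open>n\<close> sent over \<open>e\<close> by
  \<open>v\<close> raises it by at least 1, so it bounds the number of rounds spent on such
  items.\<close>

definition load :: "nat \<Rightarrow> nat \<Rightarrow> nat \<Rightarrow> edge \<Rightarrow> nat" where
  "load n r v e = (\<Sum>k<n. rank (sent (state r v) e k))"

lemma rank_sent_Suc:
  assumes "sent (state (Suc r) v) e k \<noteq> sent (state r v) e k"
  shows "rank (sent (state r v) e k) < rank (sent (state (Suc r) v) e k)"
proof -
  obtain A where "A \<subseteq> heard (state r v) k" "sent (state r v) e k = summary A"
    using sent_summary[of r v k e] by blast
  moreover have "sent (state (Suc r) v) e k = summary (heard (state r v) k)"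
    using assms by (rule sent_Suc_cases) simp
  ultimately show ?thesis
    using rank_less_summary[of A] assms by simp
qed

lemma supports_sent_Suc:
  assumes "supports m (sent (state r v) e k)"
  shows "supports m (sent (state (Suc r) v) e k)"
proof (cases "sent (state (Suc r) v) e k = sent (state r v) e k")
  case False
  obtain A where "A \<subseteq> heard (state r v) k" "sent (state r v) e k = summary A"
    using sent_summary[of r v k e] by blast
  moreover have "sent (state (Suc r) v) e k = summary (heard (state r v) k)"
    using False by (rule sent_Suc_cases) simp
  ultimately show ?thesis
    using supports_mono[of A] assms by simp
qed (use assms in simp)

lemma load_Suc: "load n r v e \<le> load n (Suc r) v e"
  unfolding load_def using rank_sent_Suc by (intro sum_mono) (metis less_imp_le order_refl)

lemma load_Suc_pending:
  assumes "pending Q (K v) (state r v) e k" "k < n"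
  shows "load n r v e < load n (Suc r) v e"
proof -
  obtain k' x where k': "next_item Q (K v) (state r v) e = Some (k', x)" "k' \<le> k"
    using assms(1) by (rule next_item_pending)
  then have "sent (state (Suc r) v) e k' \<noteq> sent (state r v) e k'"
    using next_item_eq_Some[OF k'(1)] by (auto simp: sent_Suc pending_def)
  then have "rank (sent (state r v) e k') < rank (sent (state (Suc r) v) e k')"
    by (rule rank_sent_Suc)
  then show ?thesis
    unfolding load_def using k'(2) assms(2) rank_sent_Suc
    by (intro sum_strict_mono_ex1) (auto, metis less_imp_le order_refl)
qed

lemma sent_idle:
  assumes "\<not> pending Q (K v) (state r v) e k" "e \<in> edges G" "v \<in> e" "mem e k"
  shows "sent (state r v) e k = summary (heard (state r v) k)"
proof (cases "heard (state r v) k = {}")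
  case True
  then show ?thesis
    using sent_summary[of r v k e] by auto
next
  case False
  then show ?thesis
    using assms member_iff by (auto simp: pending_def summary_eq_None_iff)
qed

lemma load_le:
  assumes "e \<in> edges G" "v \<in> e"
  shows "load n r v e \<le> 2 * card {k. k < n \<and> mem e k}"
proof -
  have "load n r v e \<le> (\<Sum>k<n. if mem e k then 2 else 0)"
    unfolding load_def
  proof (rule sum_mono)
    show "rank (sent (state r v) e k) \<le> (if mem e k then 2 else 0)" for k
      using sent_mem[OF assms, of r k] rank_le_2 by (cases "sent (state r v) e k") auto
  qed
  also have "\<dots> = 2 * card {k. k < n \<and> mem e k}"
    by (simp add: sum.If_cases Collect_conj_eq lessThan_def)
  finally show ?thesis .
qed

text \<open>On a common index, the idle \<open>v\<close> has sent the summary of all it heard,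
  including the value from \<open>u\<close>, so its rank is no smaller. Every other index
  contributes at most 2.\<close>

lemma load_idle:
  assumes "{u, v} \<in> edges G" "{u, v} \<notin> F" "e \<in> edges G" "v \<in> e"
    and "\<And>k. k < n \<Longrightarrow> \<not> pending Q (K v) (state r v) e k"
    and "card {k. k < n \<and> mem {u, v} k \<and> \<not> mem e k} \<le> w"
  shows "load n r u {u, v} \<le> load n r v e + 2 * w"
proof -
  let ?B = "{k. k < n \<and> mem {u, v} k \<and> \<not> mem e k}"
  have "rank (sent (state r u) {u, v} k) \<le>
      rank (sent (state r v) e k) + (if k \<in> ?B then 2 else 0)" if "k < n" for k
  proof (cases "sent (state r u) {u, v} k")
    case (Some x)
    then have mem: "mem {u, v} k" and x: "x \<in> heard (state r v) k"
      using sent_mem[OF assms(1)] sent_heard[OF assms(1,2)] by auto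
    show ?thesis
    proof (cases "mem e k")
      case True
      then show ?thesis
        using Some sent_idle[OF assms(5)[OF that] assms(3,4)] rank_summary_ge[OF x] by simp
    next
      case False
      then show ?thesis
        using mem that rank_le_2[of "sent (state r u) {u, v} k"] by simp
    qed
  qed simp
  then have "load n r u {u, v} \<le>
      (\<Sum>k<n. rank (sent (state r v) e k) + (if k \<in> ?B then 2 else 0))"
    unfolding load_def by (intro sum_mono) simp
  also have "\<dots> = load n r v e + 2 * card ?B"
  proof -
    have "{..<n} \<inter> ?B = ?B" by auto
    then show ?thesis
      by (simp add: sum.distrib load_def sum.If_cases del: mem_Collect_eq)
  qed
  finally show ?thesis
    using assms(6) by simp
qed

text \<open>An edge of a path that is idle has caught up with the preceding edge, except for the at most
  \<open>w\<close> indices available only there. As long as the relevant index has not passed an edge, all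
  earlier rounds are thus accounted for by items sent, up to \<open>1 + 2 * w\<close> rounds per hop.\<close>

lemma pipelining:
  assumes "p ! 0 = s" "i < n"
    and "\<And>j. Suc j < length p \<Longrightarrow> {p ! j, p ! Suc j} \<in> edges G - F \<and> mem {p ! j, p ! Suc j} i"
    and "\<And>e e'. e \<in> edges G \<Longrightarrow> e' \<in> edges G \<Longrightarrow> card {k. k < n \<and> mem e k \<and> \<not> mem e' k} \<le> w"
    and "Suc j < length p"
    and "\<not> supports m0 (sent (state t (p ! j)) {p ! j, p ! Suc j} i)"
  shows "t \<le> load n t (p ! j) {p ! j, p ! Suc j} + j * (1 + 2 * w)"
  using assms(5,6)
proof (induction j arbitrary: t)
  case 0
  let ?e = "{p ! 0, p ! Suc 0}"
  show ?case
    using 0(2)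
  proof (induction t)
    case (Suc t)
    then have not: "\<not> supports m0 (sent (state t (p ! 0)) ?e i)"
      using supports_sent_Suc by blast
    \<comment> \<open>The source holds \<open>m0\<close> from the start, so the index stays pending
      until it is served, and each round until then raises the load.\<close>
    have "supports m0 (summary (heard (state t (p ! 0)) i))"
      using source_heard assms(1) by (intro supports_summary[of "Some m0"]) (auto simp: supports_def)
    then have "pending Q (K (p ! 0)) (state t (p ! 0)) ?e i"
      using not sent_idle[of "p ! 0" t ?e i] assms(3)[OF 0(1)]
      by (cases "pending Q (K (p ! 0)) (state t (p ! 0)) ?e i") auto
    then show ?case
      using load_Suc_pending[OF _ assms(2)] Suc.IH[OF not] by fastforce
  qed simp
next
  case (Suc j)
  let ?u = "p ! j" and ?v = "p ! Suc j" and ?e = "{p ! Suc j, p ! Suc (Suc j)}"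
  have previous_edge: "t \<le> load n t ?u {?u, ?v} + j * (1 + 2 * w)"
    if "\<not> supports m0 (sent (state t ?u) {?u, ?v} i)" for t
    using Suc.IH[OF _ that] Suc.prems(1) by simp
  have d: "{?u, ?v} \<in> edges G" "{?u, ?v} \<notin> F" and e: "?e \<in> edges G" "mem ?e i"
    using assms(3)[of j] assms(3)[OF Suc.prems(1)] Suc.prems(1) by auto
  show ?case
    using Suc.prems(2)
  proof (induction t)
    case (Suc t)
    then have not: "\<not> supports m0 (sent (state t ?v) ?e i)"
      using supports_sent_Suc by blast
    show ?case
    proof (cases "\<exists>k<n. pending Q (K ?v) (state t ?v) ?e k")
      case True
      then obtain k where "k < n" "pending Q (K ?v) (state t ?v) ?e k"
        by blast
      then show ?thesis
        using load_Suc_pending Suc.IH[OF not] by fastforce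
    next
      case False
      \<comment> \<open>Nothing is pending, yet the index has not been passed on; hence
        \<open>v\<close> lacks support, the preceding edge has not delivered it, and the bound for
        that edge applies. The hop adds \<open>2 * w\<close> for the indices available only there
        and 1 for the current round.\<close>
      then have "\<not> supports m0 (summary (heard (state t ?v) i))"
        using not sent_idle[of ?v t ?e i] e assms(2) by auto
      then have "\<not> supports m0 (sent (state t ?u) {?u, ?v} i)"
        using supports_sent_heard[OF d] by blast
      then have "t \<le> load n t ?u {?u, ?v} + j * (1 + 2 * w)"
        using previous_edge by blast
      also have "load n t ?u {?u, ?v} \<le> load n t ?v ?e + 2 * w"
        using False e(1) by (intro load_idle[OF d] assms(4)[OF d(1)]) auto
      also have "load n t ?v ?e \<le> load n (Suc t) ?v ?e"
        by (rule load_Suc)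
      finally show ?thesis
        by simp
    qed
  qed simp
qed

text \<open>The load of an edge never exceeds \<open>2 * x\<close>. Later than the stated time, the
  pipelining bound thus forces the last edge of the path to have delivered its support; a path of
  one vertex ends at the source.\<close>

lemma heard_after:
  assumes "p \<noteq> []" "p ! 0 = s" "i < n"
    and "\<And>j. Suc j < length p \<Longrightarrow> {p ! j, p ! Suc j} \<in> edges G - F \<and> mem {p ! j, p ! Suc j} i"
    and "\<And>e e'. e \<in> edges G \<Longrightarrow> e' \<in> edges G \<Longrightarrow> card {k. k < n \<and> mem e k \<and> \<not> mem e' k} \<le> w"
    and "\<And>e. e \<in> edges G \<Longrightarrow> card {k. k < n \<and> mem e k} \<le> x"
    and "2 * x + path_length p * (1 + 2 * w) < t"
  shows "supports m0 (summary (heard (state t (last p)) i))"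
proof (cases "length p = 1")
  case True
  then have "last p = s"
    using assms(1,2) by (simp add: last_conv_nth)
  then show ?thesis
    using source_heard by (intro supports_summary[of "Some m0"]) (auto simp: supports_def)
next
  case False
  define j where "j = length p - 2"
  then have j: "Suc j < length p" "last p = p ! Suc j" "path_length p = Suc j"
    using False assms(1) by (auto simp: last_conv_nth path_length_def Suc_diff_Suc numeral_2_eq_2
        neq_Nil_conv)
  let ?u = "p ! j" and ?e = "{p ! j, p ! Suc j}"
  have e: "?e \<in> edges G" "?e \<notin> F"
    using assms(4)[OF j(1)] by auto
  have "supports m0 (sent (state t ?u) ?e i)"
  proof (rule ccontr)
    assume "\<not> ?thesis"
    then have "t \<le> load n t ?u ?e + j * (1 + 2 * w)"
      using assms(2-5) j(1) by (intro pipelining) auto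
    also have "load n t ?u ?e \<le> 2 * x"
      using load_le[OF e(1), of ?u n t] assms(6)[OF e(1)] by simp
    finally show False
      using assms(7) j(3) by simp
  qed
  then show ?thesis
    using supports_sent_heard[OF e] j(2) by simp
qed

subsection \<open>Liveness\<close>

text \<open>Once each endpoint has support in some subgraph without the edge concerned, a claim is
  accepted at once, and acceptance moves one hop per round along a fault-free path.\<close>

lemma accepted_along_path:
  assumes "p ! 0 = s"
    and "\<And>j. Suc j < length p \<Longrightarrow> {p ! j, p ! Suc j} \<in> edges G - F"
    and "\<And>t e v. T \<le> t \<Longrightarrow> e \<in> edges G \<Longrightarrow> v \<in> e \<Longrightarrow>
      \<exists>k. \<not> mem e k \<and> supports m0 (summary (heard (state t v) k))"
  shows "j < length p \<Longrightarrow> T + j \<le> t \<Longrightarrow> accepted (state t (p ! j)) = Some m0"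
proof (induction j arbitrary: t)
  case 0
  have "accepted (state t s) = Some m0"
    by (induction t) (auto simp: state_0 accepted_Suc)
  then show ?case
    using assms(1) by simp
next
  case (Suc j)
  then obtain t' where t': "t = Suc t'" "T + j \<le> t'"
    by (cases t) auto
  let ?u = "p ! j" and ?v = "p ! Suc j"
  have e: "{?u, ?v} \<in> edges G" "{?u, ?v} \<notin> F"
    using assms(2)[OF Suc.prems(1)] by auto
  obtain ib where ib: "state (Suc t') ?v = step Q (K ?v) (state t' ?v) ib"
    "\<And>u. {u, ?v} \<in> edges G \<Longrightarrow> {u, ?v} \<notin> F \<Longrightarrow>
       decode (ib {u, ?v}) = (accepted (state t' u), next_item Q (K u) (state t' u) {u, ?v})"
    by (rule state_Suc[of t' ?v]) blast
  have "accepted (state t' ?u) = Some m0"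
    using Suc t'(2) by simp
  then have "fst (decode (ib {?u, ?v})) = Some m0"
    using ib(2)[OF e] by simp
  moreover obtain k where "\<not> mem {?u, ?v} k" "supports m0 (summary (heard (state t' ?v) k))"
    using assms(3)[of t' "{?u, ?v}" ?v] t'(2) e(1) by auto
  ultimately have "acceptable Q (K ?v) (state t' ?v) ib m0"
    using e(1) member_iff[OF e(1), of ?v k]
    by (auto simp: acceptable_def incident_K intro!: bexI[of _ "{?u, ?v}"])
  \<comment> \<open>The choice made by \<open>Eps\<close> is harmless: some message is accepted, and
    by safety it is \<open>m0\<close>.\<close>
  then have "accepted (state t ?v) \<noteq> None"
    unfolding t'(1) ib(1) step_def by auto
  then show ?case
    using accepted_safe[of t ?v] by auto
qed

text \<open>Two phases: support spreads within \<open>2 * x + L * (1 + 2 * w) + 1\<close> rounds,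
  then acceptance needs at most \<open>L\<close> more. The parameters \<open>n\<close>,
  \<open>w\<close> and \<open>x\<close> stay open because short and long families call for different
  ranges of indices.\<close>

lemma all_accept:
  assumes short: "\<And>F' v. F' \<subseteq> edges G \<Longrightarrow> card F' \<le> 2 \<Longrightarrow> v \<in> verts G \<Longrightarrow>
      \<exists>p. is_path (delete_edges G F') s p v \<and> path_length p \<le> L"
    and cover: "\<And>f p v. f \<in> edges G \<Longrightarrow> v \<in> verts G \<Longrightarrow> is_path (delete_edges G {f}) s p v \<Longrightarrow>
      path_length p \<le> L \<Longrightarrow> \<exists>k<n. \<not> mem f k \<and> (\<forall>e\<in>path_edges p. mem e k)"
    and width: "\<And>e e'. e \<in> edges G \<Longrightarrow> e' \<in> edges G \<Longrightarrow>
      card {k. k < n \<and> mem e k \<and> \<not> mem e' k} \<le> w"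
    and size: "\<And>e. e \<in> edges G \<Longrightarrow> card {k. k < n \<and> mem e k} \<le> x"
    and v: "v \<in> verts G"
    and r: "2 * x + L * (1 + 2 * w) + 1 + L \<le> r"
  shows "accepted (state r v) = Some m0"
proof -
  have path_nth: "p \<noteq> []" "p ! 0 = s" "last p = u"
    "\<And>j. Suc j < length p \<Longrightarrow> {p ! j, p ! Suc j} \<in> edges G - F'"
    if "is_path (delete_edges G F') s p u" for p u F'
    using that path_edges_nth[of _ p]
    by (auto simp: is_path_def path_in_def delete_edges_def hd_conv_nth)
  have support: "\<exists>k. \<not> mem f k \<and> supports m0 (summary (heard (state t u) k))"
    if tfu: "2 * x + L * (1 + 2 * w) + 1 \<le> t" "f \<in> edges G" "u \<in> f" for t f u
  proof -
    have "u \<in> verts G"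
      using graph tfu(2,3) by (auto simp: simple_graph_def)
    moreover have "card (insert f F) \<le> 2" "insert f F \<subseteq> edges G"
      using faulty tfu(2) card_insert_le_m1[of 2 F f] by auto
    ultimately obtain p where p: "is_path (delete_edges G (insert f F)) s p u" "path_length p \<le> L"
      using short by blast
    \<comment> \<open>Only \<open>f\<close> is handed to the covering property. The resulting
      subgraph may contain the faulty edge, but the path within it does not.\<close>
    then have "is_path (delete_edges G {f}) s p u"
      by (auto simp: is_path_def path_in_def delete_edges_def)
    then obtain k where k: "k < n" "\<not> mem f k" "\<forall>e\<in>path_edges p. mem e k"
      using cover p(2) tfu(2) \<open>u \<in> verts G\<close> by blast
    have "path_length p * (1 + 2 * w) \<le> L * (1 + 2 * w)"
      using p(2) by (rule mult_le_mono1)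
    then have "2 * x + path_length p * (1 + 2 * w) < t"
      using tfu(1) by linarith
    then have "supports m0 (summary (heard (state t (last p)) k))"
      using path_nth[OF p(1)] k path_edges_nth width size by (intro heard_after) auto
    then show ?thesis
      using k(2) path_nth(3)[OF p(1)] by blast
  qed
  obtain p where p: "is_path (delete_edges G F) s p v" "path_length p \<le> L"
    using short[OF faulty(1) _ v] faulty(2) by auto
  have "accepted (state r (p ! path_length p)) = Some m0"
    using path_nth[OF p(1)] support p(2) r
    by (intro accepted_along_path[of p "2 * x + L * (1 + 2 * w) + 1"]) (auto simp: path_length_def)
  then show ?thesis
    using path_nth[OF p(1)] by (simp add: last_conv_nth path_length_def)
qed

section \<open>Running time in terms of width and size of the family\<close>

lemma result_view: "result (verified_flooding \<kappa>) (K v) (view r v) = accepted (state r v)"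
  by (simp add: verified_flooding_def state_def initial_knowledge_def)

lemma card_missing_le_width:
  assumes "e \<in> edges G"
  shows "card {i. i < length Gs \<and> e \<notin> edges (Gs ! i)} \<le> width G Gs"
proof -
  have "{card {i. i < length Gs \<and> e \<notin> edges (Gs ! i)} | e. e \<in> edges G} =
      (\<lambda>e. card {i. i < length Gs \<and> e \<notin> edges (Gs ! i)}) ` edges G"
    by auto
  then have "finite {card {i. i < length Gs \<and> e \<notin> edges (Gs ! i)} | e. e \<in> edges G}"
    using finite_edges by simp
  then show ?thesis
    unfolding width_def using assms by (intro Max_ge) auto
qed

lemma accepted_in_time:
  assumes conn: "edge_connected 3 G" and s: "s \<in> verts G" and diam: "diameter G \<le> D'"
    and ids: "\<And>v. v \<in> verts G \<Longrightarrow> v < Q" and cover: "covering_family (7 * D') 1 G Gs"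
    and v: "v \<in> verts G" and r: "9 * (width G Gs * (7 * D') + length Gs) \<le> r"
  shows "accepted (state r v) = Some m0"
proof -
  let ?L = "7 * D'" and ?w = "width G Gs"
  have connected: "connected_graph (delete_edges G F')" if "F' \<subseteq> edges G" "card F' \<le> 2" for F'
    using conn that by (auto simp: edge_connected_def)
  have G: "connected_graph G"
    using connected[of "{}"] by (simp add: delete_edges_def)
  \<comment> \<open>A second vertex yields a positive diameter, which gives
    \<open>5 * diameter G + 2 \<le> 7 * D'\<close>.\<close>
  obtain u where u: "u \<in> verts G" "u \<noteq> s"
  proof -
    have "\<not> verts G \<subseteq> {s}"
      using conn card_mono[of "{s}" "verts G"] by (auto simp: edge_connected_def)
    then show ?thesis
      using that by blast
  qed
  then obtain i where i: "i \<le> diameter G" "(s, u) \<in> adj G ^^ i"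
    using diameter_relpow[OF G graph s] by blast
  have "i \<noteq> 0"
    using i(2) u(2) by (cases i) auto
  then have D: "1 \<le> D'"
    using i(1) diam by simp
  have short: "\<exists>p. is_path (delete_edges G F') s p x \<and> path_length p \<le> ?L"
    if F': "F' \<subseteq> edges G" "card F' \<le> 2" and x: "x \<in> verts G" for F' x
  proof -
    have "finite F'"
      using F'(1) finite_edges by (rule finite_subset)
    then obtain j where j: "j \<le> 5 * diameter G + 2" "(s, x) \<in> adj (delete_edges G F') ^^ j"
      using relpow_delete_two_edges[OF graph G connected[OF F'] _ F'(2) s x] by blast
    have "s \<in> verts (delete_edges G F')"
      using s by (simp add: delete_edges_def)
    then obtain p where "is_path (delete_edges G F') s p x" "path_length p \<le> j"
      using relpow_path[OF simple_graph_delete_edges[OF graph] j(2)] by blast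
    moreover have "j \<le> ?L"
      using j(1) diam D by simp
    ultimately show ?thesis
      by (meson order_trans)
  qed
  \<comment> \<open>Covering the one-vertex path at \<open>s\<close> for a deleted edge
    \<open>e\<close> yields a member without \<open>e\<close>. Positive width is what lets
    \<open>?w * ?L\<close> absorb the terms in \<open>?L\<close> alone.\<close>
  have "?w \<noteq> 0"
  proof -
    have "\<exists>x. (x, u) \<in> adj G"
      using i(2) \<open>i \<noteq> 0\<close> by (cases i) auto
    then obtain e where e: "e \<in> edges G"
      by (auto simp: adj_def)
    have "is_path (delete_edges G {e}) s [s] s" "path_length [s] \<le> ?L"
      using s by (auto simp: is_path_def path_in_def path_length_def delete_edges_def)
    moreover have "{e} \<subseteq> edges G" "card {e} \<le> 1"
      using e by auto
    ultimately obtain H where "H \<in> set Gs" "{e} \<inter> edges H = {}"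
      using cover s unfolding covering_family_def by blast
    then have "{i. i < length Gs \<and> e \<notin> edges (Gs ! i)} \<noteq> {}"
      by (auto simp: in_set_conv_nth)
    then have "0 < card {i. i < length Gs \<and> e \<notin> edges (Gs ! i)}"
      by (simp add: card_gt_0_iff)
    then show ?thesis
      using card_missing_le_width[OF e] by simp
  qed
  define P where "P = ?w * ?L"
  have P: "?L \<le> P" "1 \<le> P" "9 * (P + length Gs) \<le> r"
    using \<open>?w \<noteq> 0\<close> D r by (auto simp: P_def)
  have P_eq: "?L * (1 + 2 * ?w) = ?L + 2 * P" "?L * (1 + 2 * (?w + 2)) = 5 * ?L + 2 * P"
    by (simp_all add: P_def algebra_simps)
  show ?thesis
  proof (cases "length Gs \<le> Q\<^sup>2")
    \<comment> \<open>All members of the family have small indices. Those from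
      \<open>length Gs\<close> up to the square of \<open>Q\<close> are available on no edge, so
      width and size are those of \<open>Gs\<close>.\<close>
    case True
    show ?thesis
    proof (rule all_accept[where n = "Q\<^sup>2" and L = ?L and w = ?w and x = "length Gs"])
      fix f p x
      assume f: "f \<in> edges G" and x: "x \<in> verts G"
        and p: "is_path (delete_edges G {f}) s p x" "path_length p \<le> ?L"
      have "{f} \<subseteq> edges G" "card {f} \<le> 1"
        using f by auto
      then obtain H where "H \<in> set Gs" "path_in p H" "{f} \<inter> edges H = {}"
        using cover s x p unfolding covering_family_def by blast
      then obtain k where "k < length Gs" "path_in p (Gs ! k)" "f \<notin> edges (Gs ! k)"
        by (auto simp: in_set_conv_nth)
      then show "\<exists>k<Q\<^sup>2. \<not> mem f k \<and> (\<forall>e\<in>path_edges p. mem e k)"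
        using True by (intro exI[of _ k]) (auto simp: mem_def path_in_def)
    next
      fix e e' assume e': "e' \<in> edges G"
      have "card {k. k < Q\<^sup>2 \<and> mem e k \<and> \<not> mem e' k}
          \<le> card {i. i < length Gs \<and> e' \<notin> edges (Gs ! i)}"
        by (rule card_mono) (auto simp: mem_def)
      also have "\<dots> \<le> ?w"
        using e' by (rule card_missing_le_width)
      finally show "card {k. k < Q\<^sup>2 \<and> mem e k \<and> \<not> mem e' k} \<le> ?w" .
    next
      fix e
      have "card {k. k < Q\<^sup>2 \<and> mem e k} \<le> card {..<length Gs}"
        by (rule card_mono) (auto simp: mem_def)
      then show "card {k. k < Q\<^sup>2 \<and> mem e k} \<le> length Gs"
        by simp
    next
      show "2 * length Gs + ?L * (1 + 2 * ?w) + 1 + ?L \<le> r"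
        using P unfolding P_eq by simp
    qed (use short v in auto)
  next
    \<comment> \<open>The family is longer than the square of \<open>Q\<close>, so running through
      all subgraphs that omit one edge costs no more than its size. They take over the
      covering.\<close>
    case False
    show ?thesis
    proof (rule all_accept[where n = "2 * Q\<^sup>2" and L = ?L and w = "?w + 2" and x = "2 * length Gs"])
      fix f p x
      assume f: "f \<in> edges G" and p: "is_path (delete_edges G {f}) s p x"
      obtain a b where ab: "f = {a, b}" "a < Q" "b < Q"
        using f graph ids by (fastforce simp: simple_graph_def)
      let ?k = "Q\<^sup>2 + (a * Q + b)"
      have "a * Q + b < Suc a * Q"
        using ab(3) by simp
      also have "\<dots> \<le> Q\<^sup>2"
        unfolding power2_eq_square using ab(2) by (intro mult_le_mono1) simp
      finally have k: "?k < 2 * Q\<^sup>2"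
        by simp
      have quotient: "(a * q + b) div q = a" if "b < q" for q
        using that by auto
      have code: "(?k - Q\<^sup>2) div Q = a" "(?k - Q\<^sup>2) mod Q = b"
        using quotient[OF ab(3)] ab(3) by simp_all
      have "mem e ?k \<longleftrightarrow> e \<noteq> f" for e
        unfolding mem_def code ab(1) using k by simp
      then show "\<exists>k<2 * Q\<^sup>2. \<not> mem f k \<and> (\<forall>e\<in>path_edges p. mem e k)"
        using k p by (intro exI[of _ ?k]) (auto simp: is_path_def path_in_def delete_edges_def)
    next
      fix e e' assume e': "e' \<in> edges G"
      obtain a b where ab: "e' = {a, b}"
        using e' graph by (auto simp: simple_graph_def)
      \<comment> \<open>Besides the members of \<open>Gs\<close> without \<open>e'\<close>, only the
        codes of its two ordered pairs of endpoints are missing; hence the increase of the width by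
        2.\<close>
      let ?M = "{i. i < length Gs \<and> e' \<notin> edges (Gs ! i)}"
        and ?C = "{Q\<^sup>2 + (a * Q + b), Q\<^sup>2 + (b * Q + a)}"
      have "{k. k < 2 * Q\<^sup>2 \<and> mem e k \<and> \<not> mem e' k} \<subseteq> ?M \<union> ?C"
      proof
        fix k assume k: "k \<in> {k. k < 2 * Q\<^sup>2 \<and> mem e k \<and> \<not> mem e' k}"
        show "k \<in> ?M \<union> ?C"
        proof (cases "k < Q\<^sup>2")
          case True
          then show ?thesis
            using k by (auto simp: mem_def)
        next
          case False
          define d m where "d = (k - Q\<^sup>2) div Q" and "m = (k - Q\<^sup>2) mod Q"
          have "{a, b} = {d, m}"
            using k False by (auto simp: mem_def ab d_def m_def)
          moreover have "k = Q\<^sup>2 + (d * Q + m)"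
            using False unfolding d_def m_def div_mult_mod_eq by simp
          ultimately show ?thesis
            by (auto simp: doubleton_eq_iff)
        qed
      qed
      then have "card {k. k < 2 * Q\<^sup>2 \<and> mem e k \<and> \<not> mem e' k} \<le> card (?M \<union> ?C)"
        by (rule card_mono[rotated]) simp
      also have "\<dots> \<le> card ?M + card ?C"
        by (rule card_Un_le)
      also have "\<dots> \<le> ?w + 2"
        using card_missing_le_width[OF e'] by (intro add_mono) (auto simp: card_insert_if)
      finally show "card {k. k < 2 * Q\<^sup>2 \<and> mem e k \<and> \<not> mem e' k} \<le> ?w + 2" .
    next
      fix e
      have "card {k. k < 2 * Q\<^sup>2 \<and> mem e k} \<le> card {..<2 * Q\<^sup>2}"
        by (rule card_mono) auto
      then show "card {k. k < 2 * Q\<^sup>2 \<and> mem e k} \<le> 2 * length Gs"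
        using False by simp
    next
      \<comment> \<open>Here the factor 9 is attained:
        \<open>6 * ?L + 2 * P + 1 \<le> 9 * P\<close>.\<close>
      show "2 * (2 * length Gs) + ?L * (1 + 2 * (?w + 2)) + 1 + ?L \<le> r"
        using P unfolding P_eq by simp
    qed (use short v in auto)
  qed
qed

end

section \<open>Bandwidth and round bounds combined\<close>

theorem theorem4:
  fixes c :: real and \<kappa> :: nat
  assumes "c \<ge> 1"
  shows "\<exists>(A :: algorithm) (B :: nat) (C :: nat).
    \<forall>(G :: graph) (s :: nat) (m0 :: msg) (N :: nat) (D' :: nat) (L :: nat) (Gs :: graph list).
      simple_graph G \<and> edge_connected 3 G \<and> s \<in> verts G \<and>
      congest_parameters \<kappa> G m0 N \<and>
      diameter G \<le> D' \<and> real D' \<le> c * real (diameter G) \<and>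
      L = 7 * D' \<and> covering_family L 1 G Gs
      \<longrightarrow> solves_broadcast A B 1 G (initial_knowledge G s m0 N D' Gs) m0
            (C * (width G Gs * L + length Gs))"
proof (rule exI[of _ "verified_flooding \<kappa>"], rule exI[of _ "13 + 8 * (\<kappa> * (\<kappa> * \<kappa>))"],
    rule exI[of _ 9], intro allI impI)
  fix G :: graph and s :: nat and m0 :: msg and N D' L :: nat and Gs :: "graph list"
  assume asm: "simple_graph G \<and> edge_connected 3 G \<and> s \<in> verts G \<and>
      congest_parameters \<kappa> G m0 N \<and>
      diameter G \<le> D' \<and> real D' \<le> c * real (diameter G) \<and>
      L = 7 * D' \<and> covering_family L 1 G Gs"
  let ?n = "card (verts G)" and ?Q = "N ^ (\<kappa> * \<kappa>)" and ?B = "13 + 8 * (\<kappa> * (\<kappa> * \<kappa>))"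
  have n: "2 \<le> ?n" and ids: "\<And>v. v \<in> verts G \<Longrightarrow> v < ?n ^ \<kappa>"
    and len: "real (length m0) \<le> real \<kappa> * log 2 (real ?n)"
    and N: "?n \<le> N ^ \<kappa>" "N \<le> ?n ^ \<kappa>"
    using asm by (auto simp: congest_parameters_def edge_connected_def)
  \<comment> \<open>With at least two vertices, the additive constant 13 is absorbed into a multiple
    of \<open>log n\<close>.\<close>
  have log: "1 \<le> log 2 (real ?n)"
    using n by simp
  have Q: "?n ^ \<kappa> \<le> ?Q"
    using power_mono[OF N(1), of \<kappa>] by (simp add: power_mult)
  have "?Q \<le> ?n ^ (\<kappa> * (\<kappa> * \<kappa>))"
    using power_mono[OF N(2), of "\<kappa> * \<kappa>"] by (simp flip: power_mult)
  moreover have "0 < ?Q"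
    using Q n by (metis gr0I le_zero_eq not_numeral_le_zero power_eq_0_iff)
  ultimately have "log 2 (real ?Q) \<le> log 2 (real (?n ^ (\<kappa> * (\<kappa> * \<kappa>))))"
    by (subst log_le_cancel_iff) (use n in \<open>auto simp flip: of_nat_power\<close>)
  also have "\<dots> = real (\<kappa> * (\<kappa> * \<kappa>)) * log 2 (real ?n)"
    using n by (simp add: log_nat_power)
  finally have logQ: "log 2 (real ?Q) \<le> real (\<kappa> * (\<kappa> * \<kappa>)) * log 2 (real ?n)" .
  have "2 ^ length m0 \<le> ?n ^ \<kappa>"
  proof -
    have "2 powr real (length m0) \<le> 2 powr (real \<kappa> * log 2 (real ?n))"
      using len by simp
    also have "\<dots> = real (?n ^ \<kappa>)"
      using n by (simp add: mult.commute[of "real \<kappa>"] powr_realpow flip: powr_powr)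
    finally have "real (2 ^ length m0) \<le> real (?n ^ \<kappa>)"
      by (simp add: powr_realpow)
    then show ?thesis
      by (simp only: of_nat_le_iff)
  qed
  with Q have m0: "2 ^ length m0 \<le> ?Q"
    by simp
  show "solves_broadcast (verified_flooding \<kappa>) ?B 1 G (initial_knowledge G s m0 N D' Gs) m0
      (9 * (width G Gs * L + length Gs))"
    unfolding solves_broadcast_def
  proof (intro allI impI ballI)
    fix F and adv :: adversary and r v
    assume F: "F \<subseteq> edges G \<and> card F \<le> 1 \<and>
        (\<forall>tr e v. real (length (adv tr e v)) \<le> real ?B * log 2 (real ?n))"
      and v: "v \<in> verts G"
    interpret flooding_run \<kappa> G s m0 N D' Gs F adv
      using asm F m0 by unfold_locales auto
    have "real (length (send (verified_flooding \<kappa>) (K v) (view r v) e)) \<le> real ?B * log 2 (real ?n)"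
      for e
    proof -
      have "13 + 8 * log 2 (real ?Q)
          \<le> 13 * log 2 (real ?n) + 8 * (real (\<kappa> * (\<kappa> * \<kappa>)) * log 2 (real ?n))"
        using log logQ by simp
      also have "\<dots> = real ?B * log 2 (real ?n)"
        by (simp add: algebra_simps)
      finally show ?thesis
        using length_send[of v r e] by linarith
    qed
    moreover have "accepted (state r v) = Some m0" if "9 * (width G Gs * L + length Gs) \<le> r"
      using asm ids Q v that by (intro accepted_in_time) (auto intro: less_le_trans)
    ultimately show "(\<forall>e\<in>edges G. v \<in> e \<longrightarrow>
          real (length (send (verified_flooding \<kappa>) (K v) (view r v) e))
            \<le> real ?B * log 2 (real ?n)) \<and>
        result (verified_flooding \<kappa>) (K v) (view r v) \<in> {None, Some m0} \<and>
        (9 * (width G Gs * L + length Gs) \<le> r \<longrightarrow>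
          result (verified_flooding \<kappa>) (K v) (view r v) = Some m0)"
      unfolding result_view using accepted_safe[of r v] by blast
  qed
qed

end
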